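(* (Boundedness) Let $\mathcal H$ be a nice operator. If $\mathcal H\vdash^\alpha_\rho\Gamma\cup\{\psi\}$, then $\mathcal H\vdash^\alpha_\rho\Gamma\cup\{\psi^\beta\}$ for every $\beta\in\mathcal H(\emptyset)$ with $\alpha\preceq\beta\prec\Omega$, where $\psi^\beta$ is obtained from $\psi$ by replacing every literal $I^{\prec\Omega}_\varphi t$ and $\neg I^{\prec\Omega}_\varphi t$ by $I^{\prec\beta}_\varphi t$ and $\neg I^{\prec\beta}_\varphi t$, respectively.
   Context: Ordinal terms: The set $\vartheta(\varepsilon_{\Omega+1})$ of terms, a relation $\prec$ and finite sets $E(\alpha)$ are defined by simultaneous recursion on term length: Terms: $\Omega$; $\vartheta\alpha$ for each term $\alpha$; $\langle\alpha_0,\dots,\alpha_{n-1}\rangle$ ($n\ge0$) provided that if $n>1$ then $\alpha_{n-1}\preceq\dots\preceq\alpha_0$ ($\preceq$ is $\prec$ or syntactic equality), and if $n=1$ then $\alpha_0$ is not $\Omega$ or of the form $\vartheta\beta$. $E(\Omega)=\emptyset$, $E(\vartheta\alpha)=\{\vartheta\alpha\}$, $E(\langle\alpha_0,\dots\rangle)=\bigcup_iE(\alpha_i)$. $\alpha\prec\beta$ iff: (1) $\alpha=\Omega$, $\beta=\langle\beta_0,\dots,\beta_{n-1}\rangle$, $n>0$, $\Omega\preceq\beta_0$; or (2) $\alpha=\vartheta\alpha'$ and either $\beta=\Omega$, or $\beta=\langle\beta_0,\dots\rangle$ nonempty with $\alpha\preceq\beta_0$, or $\beta=\vartheta\beta'$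 with $\alpha'\prec\beta'$ and $\gamma\prec\beta$ for all $\gamma\in E(\alpha')$, or $\beta=\vartheta\beta'$ with $\alpha\preceq\gamma$ for some $\gamma\in E(\beta')$; or (3) $\alpha=\langle\alpha_0,\dots,\alpha_{m-1}\rangle$ and either $\beta\in\{\Omega\}\cup\{\vartheta\beta'\}$ with ($m=0$ or $\alpha_0\prec\beta$), or $\beta=\langle\beta_0,\dots,\beta_{n-1}\rangle$ is lexicographically larger ($\alpha$ a proper initial segment of $\beta$, or first difference $\alpha_j\prec\beta_j$). Numerals: $n:=\langle0,\dots,0\rangle$ ($n$ entries, $0=\langle\rangle$), $\omega:=\langle 1\rangle$. Addition: identify $\Omega,\vartheta\alpha$ with $\langle\Omega\rangle,\langle\vartheta\alpha\rangle$ and set $\langle\alpha_0,\dots,\alpha_{m-1}\rangle+\langle\beta_0,\dots,\beta_{n-1}\rangle=\langle\alpha_0,\dots,\alpha_{k-1},\beta_0,\dots,\beta_{n-1}\rangle$ where $k$ is largest such that $\beta_0\preceq\alpha_{k-1}$ (all of $\alpha$ if $n=0$; $k=0$ if no such); $\omega\cdot\Omega=\Omega$, $\omega\cdot\vartheta\alpha=\vartheta\alpha$, $\omega\cdot\langle\alpha_0,\dots\rangle=\langle1+\alpha_0,\dots\rangle$. Language: formulas are in negation normal form. An operator form is a formula $\varphi(x,X)$ of arithmetic with an extra unary predicate $X$, with one free number variable and no subformula $\neg Xt$. $\mathcal L^\Omega_{\mathsf{ID}}$ extends $\mathcal L_{\mathsf{PA}}$ by predicates $I^{\prec\alpha}_\varphi$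 for each operator form $\varphi$ and term $\alpha\preceq\Omega$; $\varphi(t,I^{\prec\gamma}_\varphi)$ replaces $x$ by $t$ and $Xs$ by $I^{\prec\gamma}_\varphi s$. Each sentence is assigned a disjunction or conjunction: a false $\mathcal L_{\mathsf{PA}}$-literal $\simeq$ empty disjunction; $I^{\prec\alpha}_\varphi t\simeq\bigvee_{\gamma\prec\alpha}\varphi(t,I^{\prec\gamma}_\varphi)$; $\psi_0\lor\psi_1\simeq\bigvee_{i\prec2}\psi_i$; $\exists x\,\psi(x)\simeq\bigvee_{n\prec\omega}\psi(n)$; and $\neg\psi\simeq\bigwedge_{\gamma\prec\alpha}\neg\psi_\gamma$ whenever $\psi\simeq\bigvee_{\gamma\prec\alpha}\psi_\gamma$. Ranks: $\operatorname{rk}=0$ for $\mathcal L_{\mathsf{PA}}$-literals, $\operatorname{rk}(\pm I^{\prec\alpha}_\varphi t)=\omega\cdot\alpha$, $\operatorname{rk}(\psi_0\lor\psi_1)=\operatorname{rk}(\psi_0\land\psi_1)=\max(\operatorname{rk}\psi_0,\operatorname{rk}\psi_1)+1$, $\operatorname{rk}(\exists x\psi)=\operatorname{rk}(\forall x\psi)=\operatorname{rk}(\psi)+1$. $k(\psi)$ is the set of $\alpha$ such that $\psi$ contains a literal $I^{\prec\alpha}_\varphi t$ or $\neg I^{\prec\alpha}_\varphi t$; for a sequent (finite set of sentences) $k(\Gamma)=\bigcup_{\psi\in\Gamma}k(\psi)$. Operators: with $\mathcal P$ the powerset of $\vartheta(\varepsilon_{\Omega+1})$, a nice operator is $\mathcal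 H:\mathcal P\to\mathcal P$ with $X\subseteq\mathcal H(X)$, ($X\subseteq\mathcal H(Y)\Rightarrow\mathcal H(X)\subseteq\mathcal H(Y)$), and ($\alpha\in\mathcal H(X)\Leftrightarrow E(\alpha)\subseteq\mathcal H(X)$); $\mathcal H[Z](X):=\mathcal H(Z\cup X)$. Derivations: $\mathcal H\vdash^\alpha_\rho\Gamma$ is defined by recursion on $\alpha$: it holds iff $\{\alpha\}\cup k(\Gamma)\subseteq\mathcal H(\emptyset)$ and one of: ($\bigwedge$) some $\psi\simeq\bigwedge_{\gamma\prec\delta}\psi_\gamma$ in $\Gamma$ such that for every $\gamma\prec\delta$ there is $\alpha(\gamma)\prec\alpha$ with $\mathcal H[\{\gamma\}]\vdash^{\alpha(\gamma)}_\rho\Gamma\cup\{\psi_\gamma\}$; ($\bigvee$) some $\psi\simeq\bigvee_{\gamma\prec\delta}\psi_\gamma$ in $\Gamma$, some $\gamma\prec\delta$ with $\gamma\prec\alpha$ and $\gamma\in\mathcal H(\emptyset)$, and $\alpha'\prec\alpha$ with $\mathcal H\vdash^{\alpha'}_\rho\Gamma\cup\{\psi_\gamma\}$; (Cut) some sentence $\psi$ with $\operatorname{rk}(\psi)\prec\rho$ and $\alpha'\prec\alpha$ with $\mathcal H\vdash^{\alpha'}_\rho\Gamma\cup\{\psi\}$ and $\mathcal H\vdash^{\alpha'}_\rho\Gamma\cup\{\neg\psi\}$; (Fix) $\Omega\preceq\alpha$, some $I^{\prec\Omega}_\varphi t\in\Gamma$ and $\alpha'\prec\alpha$ with $\mathcal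 H\vdash^{\alpha'}_\rho\Gamma\cup\{\varphi(t,I^{\prec\Omega}_\varphi)\}$. *)

theory Defs
  imports Main
begin

subsection \<open>Ordinal terms\<close>

text \<open>The order and the sets \<open>E\<close> do not depend on which expressions are terms, so both are
  defined on all raw expressions; the terms are then carved out by \<open>is_term\<close>.\<close>

datatype raw = RTop | RTheta raw | RSeq "raw list"

primrec rawE :: "raw \<Rightarrow> raw set" where
  "rawE RTop = {}"
| "rawE (RTheta a) = {RTheta a}"
| "rawE (RSeq as) = \<Union> (set (map rawE as))"

lemma rawE_size: "g \<in> rawE a \<Longrightarrow> size g \<le> size a"
proof (induction a)
  case (RSeq as)
  then obtain x where x: "x \<in> set as" "g \<in> rawE x" by auto
  with RSeq.IH have "size g \<le> size x" by blast
  also have "size x \<le> size_list size as" using x(1) by (simp add: size_list_estimation')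
  finally show ?case by simp
qed auto

function (sequential) raw_less :: "raw \<Rightarrow> raw \<Rightarrow> bool" where
  "raw_less RTop (RSeq (b # bs)) \<longleftrightarrow> RTop = b \<or> raw_less RTop b"
| "raw_less RTop _ \<longleftrightarrow> False"
| "raw_less (RTheta a) RTop \<longleftrightarrow> True"
| "raw_less (RTheta a) (RSeq []) \<longleftrightarrow> False"
| "raw_less (RTheta a) (RSeq (b # bs)) \<longleftrightarrow> RTheta a = b \<or> raw_less (RTheta a) b"
| "raw_less (RTheta a) (RTheta b) \<longleftrightarrow>
     raw_less a b \<and> (\<forall>g \<in> rawE a. raw_less g (RTheta b)) \<or>
     (\<exists>g \<in> rawE b. RTheta a = g \<or> raw_less (RTheta a) g)"
| "raw_less (RSeq as) (RSeq bs) \<longleftrightarrow>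
     (\<exists>c cs. bs = as @ c # cs) \<or>
     (\<exists>j \<in> {..<min (length as) (length bs)}.
        take j as = take j bs \<and> raw_less (as ! j) (bs ! j))"
| "raw_less (RSeq []) b \<longleftrightarrow> True"
| "raw_less (RSeq (a # as)) b \<longleftrightarrow> raw_less a b"
  by pat_completeness auto
termination
proof (relation "measure (\<lambda>(a, b). size a + size b)", goal_cases)
  case (5 a b x)
  then show ?case using rawE_size[of x a] by simp
next
  case (6 a b x)
  then show ?case using rawE_size[of x b] by simp
next
  case (7 as bs x)
  then have "as ! x \<in> set as" "bs ! x \<in> set bs" by auto
  then have "size (as ! x) \<le> size_list size as" "size (bs ! x) \<le> size_list size bs"
    by (auto simp: size_list_estimation')
  then show ?case by simp
qed auto

definition raw_le :: "raw \<Rightarrow> raw \<Rightarrow> bool" where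
  "raw_le a b \<longleftrightarrow> a = b \<or> raw_less a b"

fun principal :: "raw \<Rightarrow> bool" where
  "principal (RSeq _) = False"
| "principal _ = True"

fun is_term :: "raw \<Rightarrow> bool" where
  "is_term RTop = True"
| "is_term (RTheta a) = is_term a"
| "is_term (RSeq as) \<longleftrightarrow>
     (\<forall>a \<in> set as. is_term a) \<and>
     successively (\<lambda>x y. raw_le y x) as \<and>
     (length as = 1 \<longrightarrow> \<not> principal (hd as))"

typedef oterm = "{a. is_term a}"
  by (rule exI[of _ RTop]) simp

setup_lifting type_definition_oterm

instantiation oterm :: ord
begin
lift_definition less_oterm :: "oterm \<Rightarrow> oterm \<Rightarrow> bool" is raw_less .
definition less_eq_oterm :: "oterm \<Rightarrow> oterm \<Rightarrow> bool" where
  "a \<le> b \<longleftrightarrow> a = b \<or> a < (b :: oterm)"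
instance ..
end

definition E :: "oterm \<Rightarrow> oterm set" where
  "E a = {g. Rep_oterm g \<in> rawE (Rep_oterm a)}"

lift_definition Omega :: oterm ("\<Omega>") is RTop by simp

subsection \<open>Arithmetic on ordinal terms\<close>

text \<open>\<open>entries\<close> and \<open>pack\<close> implement the identification of \<open>\<Omega>\<close> and \<open>\<vartheta>\<alpha>\<close> with the one-element
  sequences that are not themselves terms.\<close>

fun entries :: "raw \<Rightarrow> raw list" where
  "entries (RSeq as) = as"
| "entries a = [a]"

definition pack :: "raw list \<Rightarrow> raw" where
  "pack as = (if length as = 1 \<and> principal (hd as) then hd as else RSeq as)"

definition raw_plus :: "raw \<Rightarrow> raw \<Rightarrow> raw" where
  "raw_plus a b =
     (let as = entries a; bs = entries b in
      if bs = [] then a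
      else pack (take (Max ({0} \<union> {k. 1 \<le> k \<and> k \<le> length as \<and> raw_le (hd bs) (as ! (k - 1))})) as @ bs))"

abbreviation raw_one :: raw where
  "raw_one \<equiv> RSeq [RSeq []]"

fun raw_omega_times :: "raw \<Rightarrow> raw" where
  "raw_omega_times (RSeq as) = RSeq (map (raw_plus raw_one) as)"
| "raw_omega_times a = a"

lemma entries_term:
  assumes "is_term a"
  shows "(\<forall>x \<in> set (entries a). is_term x) \<and> successively (\<lambda>x y. raw_le y x) (entries a)"
  using assms by (cases a) auto

lemma pack_term:
  assumes "\<forall>x \<in> set as. is_term x" "successively (\<lambda>x y. raw_le y x) as"
  shows "is_term (pack as)"
  using assms by (cases as) (auto simp: pack_def)

lemma successively_take:
  "successively P xs \<Longrightarrow> successively P (take n xs)"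
  by (metis append_take_drop_id successively_append_iff)

lemma raw_plus_term:
  assumes a: "is_term a" and b: "is_term b"
  shows "is_term (raw_plus a b)"
proof (cases "entries b = []")
  case True
  then show ?thesis using a by (simp add: raw_plus_def)
next
  case False
  let ?as = "entries a" and ?bs = "entries b"
  let ?K = "{0} \<union> {k. 1 \<le> k \<and> k \<le> length ?as \<and> raw_le (hd ?bs) (?as ! (k - 1))}"
  define k where "k = Max ?K"
  have fin: "finite ?K" by (rule finite_subset[of _ "{..length ?as}"]) auto
  have k: "k \<in> ?K" unfolding k_def by (rule Max_in[OF fin]) auto
  have eq: "raw_plus a b = pack (take k ?as @ ?bs)"
    using False by (simp add: raw_plus_def k_def Let_def)
  have "successively (\<lambda>x y. raw_le y x) (take k ?as @ ?bs)"
  proof (cases "k = 0")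
    case True
    then show ?thesis using entries_term[OF b] by simp
  next
    case False
    with k have kk: "1 \<le> k" "k \<le> length ?as" "raw_le (hd ?bs) (?as ! (k - 1))" by auto
    then have "take k ?as \<noteq> []" by auto
    then have "last (take k ?as) = ?as ! (k - 1)" using kk by (simp add: last_conv_nth)
    then show ?thesis
      using kk entries_term[OF a] entries_term[OF b]
      by (auto simp: successively_append_iff successively_take)
  qed
  then show ?thesis
    unfolding eq using entries_term[OF a] entries_term[OF b]
    by (intro pack_term) (auto dest: in_set_takeD)
qed

lemma not_less_zero: "\<not> raw_less a (RSeq [])"
  by (cases a) auto

lemma zero_less: "a \<noteq> RSeq [] \<Longrightarrow> raw_less (RSeq []) a"
  by (cases a) (auto simp: neq_Nil_conv)

lemma raw_less_Cons:
  "raw_less (RSeq (a # as)) (RSeq (b # bs)) \<longleftrightarrow>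
     raw_less a b \<or> a = b \<and> raw_less (RSeq as) (RSeq bs)"
proof -
  have split: "(\<exists>j \<in> {..<Suc n}. P j) \<longleftrightarrow> P 0 \<or> (\<exists>j \<in> {..<n}. P (Suc j))" for n and P :: "nat \<Rightarrow> bool"
    by (simp add: lessThan_Suc_eq_insert_0)
  show ?thesis by (auto simp: split simp del: lessThan_iff bex_simps)
qed

lemma one_plus:
  "raw_plus raw_one (RSeq []) = raw_one"
  "raw_plus raw_one RTop = RTop"
  "raw_plus raw_one (RTheta a) = RTheta a"
  "raw_plus raw_one (RSeq (b # bs)) =
     (if b = RSeq [] then RSeq (RSeq [] # b # bs) else pack (b # bs))"
proof -
  have K0: "Max ({0} \<union> {k. 1 \<le> k \<and> k \<le> length [RSeq []] \<and> raw_le b ([RSeq []] ! (k - 1))}) =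
      (if b = RSeq [] then 1 else 0)" for b
  proof -
    have "{k. 1 \<le> k \<and> k \<le> length [RSeq []] \<and> raw_le b ([RSeq []] ! (k - 1))} =
        (if b = RSeq [] then {1} else {})"
      by (auto simp: raw_le_def not_less_zero le_Suc_eq)
    then show ?thesis by simp
  qed
  show "raw_plus raw_one (RSeq []) = raw_one" by (simp add: raw_plus_def)
  show "raw_plus raw_one RTop = RTop" "raw_plus raw_one (RTheta a) = RTheta a"
    unfolding raw_plus_def Let_def entries.simps list.sel K0 by (auto simp: pack_def)
  show "raw_plus raw_one (RSeq (b # bs)) =
     (if b = RSeq [] then RSeq (RSeq [] # b # bs) else pack (b # bs))"
    unfolding raw_plus_def Let_def entries.simps list.sel K0 by (auto simp: pack_def)
qed

lemma one_plus_Seq: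
  assumes "is_term (RSeq (b # bs))"
  shows "raw_plus raw_one (RSeq (b # bs)) =
     (if b = RSeq [] then RSeq (RSeq [] # b # bs) else RSeq (b # bs))"
  using assms by (auto simp: one_plus pack_def)

lemma one_plus_mono:
  assumes a: "is_term a" and b: "is_term b" and ab: "raw_le a b"
  shows "raw_le (raw_plus raw_one a) (raw_plus raw_one b)"
proof (cases "a = b")
  case True
  then show ?thesis by (simp add: raw_le_def)
next
  case False
  with ab have l: "raw_less a b" by (simp add: raw_le_def)
  have Z: "raw_less (RSeq []) (RSeq (x # xs))" for x xs by simp
  have "raw_less (raw_plus raw_one a) (raw_plus raw_one b)"
  proof (cases a)
    case RTop
    with l b show ?thesis
      by (cases b rule: entries.cases; cases "entries b")
         (auto simp: one_plus(1-3) one_plus_Seq not_less_zero)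
  next
    case (RTheta a')
    with l b show ?thesis
      by (cases b rule: entries.cases; cases "entries b")
         (auto simp: one_plus(1-3) one_plus_Seq not_less_zero)
  next
    case (RSeq as)
    show ?thesis
    proof (cases as)
      case Nil
      with RSeq have a0: "a = RSeq []" by simp
      show ?thesis
      proof (cases b)
        case (RSeq bs)
        then obtain x xs where "bs = x # xs" using l a0 not_less_zero by (cases bs) auto
        then show ?thesis using RSeq a0 b
          by (auto simp: one_plus(1) one_plus_Seq raw_less_Cons zero_less
              simp del: raw_less.simps(9) intro: Z)
      qed (auto simp: a0 one_plus)
    next
      case (Cons y ys)
      with RSeq have a1: "a = RSeq (y # ys)" by simp
      show ?thesis
      proof (cases b)
        case (RSeq bs)
        then obtain x xs where "bs = x # xs" using l not_less_zero by (cases bs) auto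
        then show ?thesis using RSeq a1 a b l
          by (auto simp: one_plus_Seq raw_less_Cons zero_less not_less_zero
              simp del: raw_less.simps(9) is_term.simps)
      qed (use a a1 l in \<open>auto simp: one_plus_Seq one_plus(2,3) simp del: is_term.simps\<close>)
    qed
  qed
  then show ?thesis by (simp add: raw_le_def)
qed

lemma one_plus_not_principal:
  assumes "is_term a" "\<not> principal a"
  shows "\<not> principal (raw_plus raw_one a)"
proof (cases a)
  case (RSeq as)
  then show ?thesis using assms
    by (cases as) (auto simp: one_plus(1) one_plus_Seq simp del: is_term.simps)
qed (use assms in auto)

lemma raw_omega_times_term:
  assumes "is_term a"
  shows "is_term (raw_omega_times a)"
proof (cases a)
  case (RSeq as)
  have "successively (\<lambda>x y. raw_le y x) (map (raw_plus raw_one) as)"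
    using assms RSeq one_plus_mono
    by (auto simp: successively_map intro: successively_mono)
  moreover have "length as = 1 \<longrightarrow> \<not> principal (hd (map (raw_plus raw_one) as))"
    using assms RSeq one_plus_not_principal by (cases as) auto
  ultimately show ?thesis
    using assms RSeq by (auto intro!: raw_plus_term)
qed (use assms in auto)

instantiation oterm :: plus
begin
lift_definition plus_oterm :: "oterm \<Rightarrow> oterm \<Rightarrow> oterm" is raw_plus
  by (rule raw_plus_term)
instance ..
end

lift_definition omega_times :: "oterm \<Rightarrow> oterm" is raw_omega_times
  by (rule raw_omega_times_term)

lift_definition onum :: "nat \<Rightarrow> oterm" is "\<lambda>n. RSeq (replicate n (RSeq []))"
  by (auto simp: raw_le_def successively_conv_nth hd_replicate)

lift_definition omega :: oterm ("\<omega>") is "RSeq [raw_one]"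
  by simp

subsection \<open>Formulas\<close>

text \<open>Formulas in negation normal form over the arithmetical signature and unary predicate symbols
  from \<open>'p\<close>, with de Bruijn indices for number variables.\<close>

datatype trm = Var nat | Zero | Succ trm | Add trm trm | Mul trm trm

datatype 'p fm =
    Eq trm trm | Neq trm trm
  | Pos 'p trm | Neg 'p trm
  | Or "'p fm" "'p fm" | And "'p fm" "'p fm"
  | Ex "'p fm" | All "'p fm"

primrec neg :: "'p fm \<Rightarrow> 'p fm" where
  "neg (Eq s t) = Neq s t"
| "neg (Neq s t) = Eq s t"
| "neg (Pos P t) = Neg P t"
| "neg (Neg P t) = Pos P t"
| "neg (Or p q) = And (neg p) (neg q)"
| "neg (And p q) = Or (neg p) (neg q)"
| "neg (Ex p) = All (neg p)"
| "neg (All p) = Ex (neg p)"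

primrec fv_trm :: "trm \<Rightarrow> nat set" where
  "fv_trm (Var i) = {i}"
| "fv_trm Zero = {}"
| "fv_trm (Succ t) = fv_trm t"
| "fv_trm (Add s t) = fv_trm s \<union> fv_trm t"
| "fv_trm (Mul s t) = fv_trm s \<union> fv_trm t"

primrec fv :: "'p fm \<Rightarrow> nat set" where
  "fv (Eq s t) = fv_trm s \<union> fv_trm t"
| "fv (Neq s t) = fv_trm s \<union> fv_trm t"
| "fv (Pos P t) = fv_trm t"
| "fv (Neg P t) = fv_trm t"
| "fv (Or p q) = fv p \<union> fv q"
| "fv (And p q) = fv p \<union> fv q"
| "fv (Ex p) = {i. Suc i \<in> fv p}"
| "fv (All p) = {i. Suc i \<in> fv p}"

text \<open>Substitution for the variable with index \<open>k\<close>. It is only used to insert closed terms, so the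
  inserted term is not lifted under quantifiers.\<close>

primrec subst_trm :: "nat \<Rightarrow> trm \<Rightarrow> trm \<Rightarrow> trm" where
  "subst_trm k u (Var i) = (if i = k then u else if k < i then Var (i - 1) else Var i)"
| "subst_trm k u Zero = Zero"
| "subst_trm k u (Succ t) = Succ (subst_trm k u t)"
| "subst_trm k u (Add s t) = Add (subst_trm k u s) (subst_trm k u t)"
| "subst_trm k u (Mul s t) = Mul (subst_trm k u s) (subst_trm k u t)"

primrec subst :: "nat \<Rightarrow> trm \<Rightarrow> 'p fm \<Rightarrow> 'p fm" where
  "subst k u (Eq s t) = Eq (subst_trm k u s) (subst_trm k u t)"
| "subst k u (Neq s t) = Neq (subst_trm k u s) (subst_trm k u t)"
| "subst k u (Pos P t) = Pos P (subst_trm k u t)"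
| "subst k u (Neg P t) = Neg P (subst_trm k u t)"
| "subst k u (Or p q) = Or (subst k u p) (subst k u q)"
| "subst k u (And p q) = And (subst k u p) (subst k u q)"
| "subst k u (Ex p) = Ex (subst (Suc k) u p)"
| "subst k u (All p) = All (subst (Suc k) u p)"

primrec val :: "(nat \<Rightarrow> nat) \<Rightarrow> trm \<Rightarrow> nat" where
  "val e (Var i) = e i"
| "val e Zero = 0"
| "val e (Succ t) = Suc (val e t)"
| "val e (Add s t) = val e s + val e t"
| "val e (Mul s t) = val e s * val e t"

abbreviation cval :: "trm \<Rightarrow> nat" where
  "cval \<equiv> val (\<lambda>_. 0)"

abbreviation numeral_trm :: "nat \<Rightarrow> trm" where
  "numeral_trm n \<equiv> (Succ ^^ n) Zero"

primrec no_neg_pred :: "'p fm \<Rightarrow> bool" where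
  "no_neg_pred (Eq s t) = True"
| "no_neg_pred (Neq s t) = True"
| "no_neg_pred (Pos P t) = True"
| "no_neg_pred (Neg P t) = False"
| "no_neg_pred (Or p q) = (no_neg_pred p \<and> no_neg_pred q)"
| "no_neg_pred (And p q) = (no_neg_pred p \<and> no_neg_pred q)"
| "no_neg_pred (Ex p) = no_neg_pred p"
| "no_neg_pred (All p) = no_neg_pred p"

text \<open>The single extra predicate \<open>X\<close> is the element of \<open>unit\<close>; the free number variable of an
  operator form has index \<open>0\<close>.\<close>

definition operator_form :: "unit fm \<Rightarrow> bool" where
  "operator_form \<phi> \<longleftrightarrow> fv \<phi> = {0} \<and> no_neg_pred \<phi>"

text \<open>The predicate symbol \<open>(\<phi>, \<alpha>)\<close> stands for \<open>I\<^sub>\<phi>\<close> restricted to stages below \<open>\<alpha>\<close>.\<close>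

type_synonym form = "(unit fm \<times> oterm) fm"

definition sentence :: "form \<Rightarrow> bool" where
  "sentence \<psi> \<longleftrightarrow> fv \<psi> = {} \<and> (\<forall>(\<phi>, \<alpha>) \<in> set_fm \<psi>. operator_form \<phi> \<and> \<alpha> \<le> \<Omega>)"

definition sequent :: "form set \<Rightarrow> bool" where
  "sequent \<Gamma> \<longleftrightarrow> finite \<Gamma> \<and> (\<forall>\<psi> \<in> \<Gamma>. sentence \<psi>)"

definition op_inst :: "unit fm \<Rightarrow> trm \<Rightarrow> oterm \<Rightarrow> form" where
  "op_inst \<phi> t \<gamma> = map_fm (\<lambda>_. (\<phi>, \<gamma>)) (subst 0 t \<phi>)"

text \<open>\<open>disj_of \<psi> \<delta> F\<close> means that \<open>\<psi>\<close> is assigned the disjunction of the \<open>F \<gamma>\<close> for \<open>\<gamma> < \<delta>\<close>; values of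
  \<open>F\<close> at other arguments are irrelevant. The terms below \<open>\<omega>\<close> are exactly the \<open>onum n\<close>.\<close>

inductive disj_of :: "form \<Rightarrow> oterm \<Rightarrow> (oterm \<Rightarrow> form) \<Rightarrow> bool" where
  "cval s \<noteq> cval t \<Longrightarrow> disj_of (Eq s t) (onum 0) F"
| "cval s = cval t \<Longrightarrow> disj_of (Neq s t) (onum 0) F"
| "disj_of (Pos (\<phi>, \<alpha>) t) \<alpha> (\<lambda>\<gamma>. op_inst \<phi> t \<gamma>)"
| "disj_of (Or p q) (onum 2) (\<lambda>\<gamma>. if \<gamma> = onum 0 then p else q)"
| "disj_of (Ex p) \<omega> (\<lambda>\<gamma>. subst 0 (numeral_trm (inv onum \<gamma>)) p)"

inductive conj_of :: "form \<Rightarrow> oterm \<Rightarrow> (oterm \<Rightarrow> form) \<Rightarrow> bool" where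
  "disj_of \<psi> \<delta> F \<Longrightarrow> conj_of (neg \<psi>) \<delta> (\<lambda>\<gamma>. neg (F \<gamma>))"

primrec rk :: "form \<Rightarrow> oterm" where
  "rk (Eq s t) = onum 0"
| "rk (Neq s t) = onum 0"
| "rk (Pos P t) = omega_times (snd P)"
| "rk (Neg P t) = omega_times (snd P)"
| "rk (Or p q) = max (rk p) (rk q) + onum 1"
| "rk (And p q) = max (rk p) (rk q) + onum 1"
| "rk (Ex p) = rk p + onum 1"
| "rk (All p) = rk p + onum 1"

definition params :: "form set \<Rightarrow> oterm set" where
  "params \<Gamma> = (\<Union>\<psi> \<in> \<Gamma>. snd ` set_fm \<psi>)"

definition bound :: "oterm \<Rightarrow> form \<Rightarrow> form" where
  "bound \<beta> \<psi> = map_fm (\<lambda>(\<phi>, \<alpha>). (\<phi>, if \<alpha> = \<Omega> then \<beta> else \<alpha>)) \<psi>"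

subsection \<open>Operators and derivations\<close>

type_synonym operator = "oterm set \<Rightarrow> oterm set"

definition nice :: "operator \<Rightarrow> bool" where
  "nice H \<longleftrightarrow>
     (\<forall>X. X \<subseteq> H X) \<and>
     (\<forall>X Y. X \<subseteq> H Y \<longrightarrow> H X \<subseteq> H Y) \<and>
     (\<forall>X \<alpha>. \<alpha> \<in> H X \<longleftrightarrow> E \<alpha> \<subseteq> H X)"

definition relativize :: "operator \<Rightarrow> oterm set \<Rightarrow> operator" where
  "relativize H Z = (\<lambda>X. H (Z \<union> X))"

text \<open>Every premise of a rule has a smaller ordinal bound than its conclusion. As \<open><\<close> on terms is
  well-founded, the recursion on the bound that characterises derivability therefore has exactly one
  solution, the inductively defined one.\<close>

inductive derives :: "operator \<Rightarrow> oterm \<Rightarrow> oterm \<Rightarrow> form set \<Rightarrow> bool" where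
  Conj: "\<lbrakk>{\<alpha>} \<union> params \<Gamma> \<subseteq> H {}; \<psi> \<in> \<Gamma>; conj_of \<psi> \<delta> F;
     \<forall>\<gamma>. \<gamma> < \<delta> \<longrightarrow> (\<exists>\<alpha>'. \<alpha>' < \<alpha> \<and> derives (relativize H {\<gamma>}) \<alpha>' \<rho> (\<Gamma> \<union> {F \<gamma>}))\<rbrakk>
   \<Longrightarrow> derives H \<alpha> \<rho> \<Gamma>"
| Disj: "\<lbrakk>{\<alpha>} \<union> params \<Gamma> \<subseteq> H {}; \<psi> \<in> \<Gamma>; disj_of \<psi> \<delta> F;
     \<gamma> < \<delta>; \<gamma> < \<alpha>; \<gamma> \<in> H {}; \<alpha>' < \<alpha>; derives H \<alpha>' \<rho> (\<Gamma> \<union> {F \<gamma>})\<rbrakk>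
   \<Longrightarrow> derives H \<alpha> \<rho> \<Gamma>"
| Cut: "\<lbrakk>{\<alpha>} \<union> params \<Gamma> \<subseteq> H {}; sentence \<psi>; rk \<psi> < \<rho>; \<alpha>' < \<alpha>;
     derives H \<alpha>' \<rho> (\<Gamma> \<union> {\<psi>}); derives H \<alpha>' \<rho> (\<Gamma> \<union> {neg \<psi>})\<rbrakk>
   \<Longrightarrow> derives H \<alpha> \<rho> \<Gamma>"
| Fix: "\<lbrakk>{\<alpha>} \<union> params \<Gamma> \<subseteq> H {}; \<Omega> \<le> \<alpha>; Pos (\<phi>, \<Omega>) t \<in> \<Gamma>; \<alpha>' < \<alpha>;
     derives H \<alpha>' \<rho> (\<Gamma> \<union> {op_inst \<phi> t \<Omega>})\<rbrakk>
   \<Longrightarrow> derives H \<alpha> \<rho> \<Gamma>"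

end

theory Submission
  imports Defs
begin

text \<open>Boundedness is proved by induction on the derivation, for a whole set of bounded formulas at
  once, so that the auxiliary formulas of the rules are bounded together with their principal
  formula. A witness of a disjunction is smaller than the height \<open>\<alpha> \<le> \<beta>\<close> of the derivation, so it
  survives when the stage \<open>\<Omega>\<close> is lowered to \<open>\<beta>\<close>; conjunctions only lose premises; and the rule
  (Fix) needs height at least \<open>\<Omega>\<close>, hence does not occur. Cut formulas are left unbounded. The only fact
  about the ordinal notations that enters is the transitivity of the order, which holds for all raw
  expressions.\<close>

section \<open>Transitivity of the order on raw expressions\<close>

lemma not_raw_less_RTop_principal: "principal c \<Longrightarrow> \<not> raw_less RTop c"
  by (cases c) auto

lemma raw_less_RSeq_Cons_principal:
  "principal b \<Longrightarrow> raw_less (RSeq (a # as)) b \<longleftrightarrow> raw_less a b"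
  by (cases b) auto

lemma raw_less_principal_RSeq_Cons:
  "principal a \<Longrightarrow> raw_less a (RSeq (b # bs)) \<longleftrightarrow> a = b \<or> raw_less a b"
  by (cases a) auto

lemma principal_or_RSeq_Cons: "a \<noteq> RSeq [] \<Longrightarrow> principal a \<or> (\<exists>d ds. a = RSeq (d # ds))"
  by (cases a) (auto simp: neq_Nil_conv)

text \<open>The clauses of \<open>raw_less\<close> may descend in either argument, so the induction
  runs on the sum of the three sizes. Away from the empty sequence, every expression is principal or
  a sequence with a head, which leaves eight shapes.\<close>

lemma raw_less_trans:
  "raw_less a b \<Longrightarrow> raw_less b c \<Longrightarrow> raw_less a c"
proof (induction "size a + size b + size c" arbitrary: a b c rule: less_induct)
  case less
  have IH: "raw_less x z"
    if "raw_less x y" "raw_less y z" "size x + size y + size z < size a + size b + size c" for x y z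
    using less.hyps that by blast
  \<comment> \<open>The induction hypothesis with one of a, b, c replaced by something smaller. The
    equality alternatives match the weak comparisons in the clauses of the order.\<close>
  have left: "raw_less x c" if "x = b \<or> raw_less x b" "size x < size a" for x
    using that less.prems IH[of x b c] by auto
  have mid: "raw_less a c" if "a = y \<or> raw_less a y" "raw_less y c" "size y < size b" for y
    using that IH[of a y c] by auto
  have right: "raw_less a z" if "b = z \<or> raw_less b z" "size z < size c" for z
    using that less.prems IH[of a b z] by auto
  have "b \<noteq> RSeq []" "c \<noteq> RSeq []" using less.prems not_less_zero by blast+
  then have b: "principal b \<or> (\<exists>d ds. b = RSeq (d # ds))"
    and c: "principal c \<or> (\<exists>d ds. c = RSeq (d # ds))"
    using principal_or_RSeq_Cons by blast+
  show ?case
  proof (cases "a = RSeq []")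
    case True
    then show ?thesis using zero_less \<open>c \<noteq> RSeq []\<close> by simp
  next
    case False
    then have a: "principal a \<or> (\<exists>d ds. a = RSeq (d # ds))"
      by (rule principal_or_RSeq_Cons)
    consider (ppp) "principal a" "principal b" "principal c"
      | (pps) d ds where "principal a" "principal b" "c = RSeq (d # ds)"
      | (psp) d ds where "principal a" "b = RSeq (d # ds)" "principal c"
      | (pss) d ds e es where "principal a" "b = RSeq (d # ds)" "c = RSeq (e # es)"
      | (spp) d ds where "a = RSeq (d # ds)" "principal b" "principal c"
      | (sps) d ds e es where "a = RSeq (d # ds)" "principal b" "c = RSeq (e # es)"
      | (ssp) d ds e es where "a = RSeq (d # ds)" "b = RSeq (e # es)" "principal c"
      | (sss) d ds e es f fs where "a = RSeq (d # ds)" "b = RSeq (e # es)" "c = RSeq (f # fs)"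
      by (insert a b c, elim disjE exE; (rule that; assumption))
    then show ?thesis
    proof cases
      case ppp
      \<comment> \<open>\<open>RTop\<close> is below no principal expression, while a and b both are
        below one.\<close>
      then obtain a' b' where ab: "a = RTheta a'" "b = RTheta b'"
        using less.prems not_raw_less_RTop_principal by (cases a; cases b) auto
      show ?thesis
      proof (cases "c = RTop")
        case True
        with ab show ?thesis by simp
      next
        case False
        with ppp obtain c' where c': "c = RTheta c'" by (cases c) auto
        have sz: "size g < size (RTheta x)" if "g \<in> rawE x" for g x
          using rawE_size[OF that] by simp
        have lt: "raw_less a' b' \<and> (\<forall>g \<in> rawE a'. raw_less g b) \<or>
            (\<exists>g \<in> rawE b'. a = g \<or> raw_less a g)"
          "raw_less b' c' \<and> (\<forall>g \<in> rawE b'. raw_less g c) \<or>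
            (\<exists>g \<in> rawE c'. b = g \<or> raw_less b g)"
          using less.prems by (simp_all add: ab c')
        \<comment> \<open>If b is not bounded by a member of \<open>rawE c'\<close>, then b' is
          below c' and all of \<open>rawE b'\<close> is below c. The two ways for a to be below b
          then give (2) and (3).\<close>
        then consider (1) h where "h \<in> rawE c'" "b = h \<or> raw_less b h"
          | (2) g where "g \<in> rawE b'" "a = g \<or> raw_less a g" "raw_less g c"
          | (3) "raw_less a' b'" "raw_less b' c'" "\<forall>g \<in> rawE a'. raw_less g b"
          by blast
        then show ?thesis
        proof cases
          case 1
          then have "raw_less a h" using right[of h] sz[of h c'] c' by blast
          with 1(1) show ?thesis by (auto simp: ab c')
        next
          case 2
          then show ?thesis using mid[of g] sz[of g b'] ab by blast
        next
          case 3
          have "raw_less a' c'" using 3 by (intro IH[of a' b' c']) (auto simp: ab c')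
          moreover have "\<forall>g \<in> rawE a'. raw_less g c"
            using 3 left sz[of _ a'] unfolding ab by blast
          ultimately show ?thesis by (simp add: ab c')
        qed
      qed
    next
      case pps
      have "b = d \<or> raw_less b d"
        using less.prems(2) pps by (simp add: raw_less_principal_RSeq_Cons)
      then have "raw_less a d" using right[of d] pps by simp
      with pps show ?thesis by (simp add: raw_less_principal_RSeq_Cons)
    next
      case psp
      have "a = d \<or> raw_less a d" "raw_less d c" using less.prems psp
        by (simp_all add: raw_less_principal_RSeq_Cons raw_less_RSeq_Cons_principal)
      then show ?thesis using mid[of d] psp by simp
    next
      case pss
      have "a = d \<or> raw_less a d" using less.prems(1) pss
        by (simp add: raw_less_principal_RSeq_Cons)
      moreover have "d = e \<or> raw_less d e" using less.prems(2) pss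
        by (simp only: raw_less_Cons) blast
      moreover have "raw_less a e" if "raw_less a d" "raw_less d e"
        using IH[OF that] pss by simp
      ultimately have "a = e \<or> raw_less a e" by blast
      with pss show ?thesis by (simp add: raw_less_principal_RSeq_Cons)
    next
      case spp
      then have "raw_less d b" using less.prems(1) by (simp add: raw_less_RSeq_Cons_principal)
      then have "raw_less d c" using left[of d] spp by simp
      with spp show ?thesis by (simp add: raw_less_RSeq_Cons_principal)
    next
      case sps
      have "raw_less d b" "b = e \<or> raw_less b e" using less.prems sps
        by (simp_all add: raw_less_principal_RSeq_Cons raw_less_RSeq_Cons_principal)
      moreover have "raw_less d e" if "raw_less d b" "raw_less b e"
        using IH[OF that] sps by simp
      ultimately have "raw_less d e" by blast
      \<comment> \<open>A strict inequality between the heads already decides the lexicographic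
        comparison.\<close>
      with sps show ?thesis by (simp only: raw_less_Cons simp_thms)
    next
      case ssp
      have "d = e \<or> raw_less d e" using less.prems(1) ssp
        by (simp only: raw_less_Cons) blast
      moreover have "raw_less e c" using less.prems(2) ssp
        by (simp add: raw_less_RSeq_Cons_principal)
      moreover have "raw_less d c" if "raw_less d e" "raw_less e c"
        using IH[OF that] ssp by simp
      ultimately have "raw_less d c" by blast
      with ssp show ?thesis by (simp add: raw_less_RSeq_Cons_principal)
    next
      case sss
      have lt: "raw_less d e \<or> d = e \<and> raw_less (RSeq ds) (RSeq es)"
        "raw_less e f \<or> e = f \<and> raw_less (RSeq es) (RSeq fs)"
        using less.prems sss by (simp_all only: raw_less_Cons)
      have "raw_less d f" if "raw_less d e" "raw_less e f"
        using IH[OF that] sss by simp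
      \<comment> \<open>The tails are themselves smaller sequences, so the induction hypothesis
        covers them as well.\<close>
      moreover have "raw_less (RSeq ds) (RSeq fs)"
        if "raw_less (RSeq ds) (RSeq es)" "raw_less (RSeq es) (RSeq fs)"
        using IH[OF that] sss by simp
      ultimately have "raw_less d f \<or> d = f \<and> raw_less (RSeq ds) (RSeq fs)"
        using lt by blast
      with sss show ?thesis by (simp only: raw_less_Cons)
    qed
  qed
qed

section \<open>Order facts for terms\<close>

lemma oterm_less_trans: "a < b \<Longrightarrow> b < c \<Longrightarrow> a < c" for a b c :: oterm
  by transfer (rule raw_less_trans)

lemma oterm_less_le_trans: "a < b \<Longrightarrow> b \<le> c \<Longrightarrow> a < c" for a b c :: oterm
  using oterm_less_trans by (auto simp: less_eq_oterm_def)

lemma oterm_le_less_trans: "a \<le> b \<Longrightarrow> b < c \<Longrightarrow> a < c" for a b c :: oterm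
  using oterm_less_trans by (auto simp: less_eq_oterm_def)

lemma oterm_less_imp_le: "a < b \<Longrightarrow> a \<le> b" for a b :: oterm
  by (simp add: less_eq_oterm_def)

text \<open>This instance of irreflexivity separates \<Omega> from the stages below it, which
  \<open>bound\<close> therefore leaves alone, and refutes (Fix) at heights below \<Omega>.\<close>

lemma Omega_not_less_Omega: "\<not> \<Omega> < \<Omega>"
  by transfer simp

section \<open>Bounding of formulas and of their assigned disjunctions and conjunctions\<close>

lemma set_fm_neg: "set_fm (neg p) = set_fm p"
  by (induction p) auto

lemma map_fm_neg: "map_fm f (neg p) = neg (map_fm f p)"
  by (induction p) auto

lemma set_fm_subst: "set_fm (subst k u p) = set_fm p"
  by (induction p arbitrary: k) auto

lemma map_fm_subst: "map_fm f (subst k u p) = subst k u (map_fm f p)"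
  by (induction p arbitrary: k) auto

text \<open>The part of \<open>sentence\<close> that concerns stages. It passes to the auxiliary
  formulas of a rule without any tracking of free variables.\<close>

definition stages_le_Omega :: "form \<Rightarrow> bool" where
  "stages_le_Omega \<psi> \<longleftrightarrow> (\<forall>\<alpha> \<in> params {\<psi>}. \<alpha> \<le> \<Omega>)"

lemma stages_le_Omega_neg: "stages_le_Omega (neg \<psi>) \<longleftrightarrow> stages_le_Omega \<psi>"
  by (simp add: stages_le_Omega_def params_def set_fm_neg)

lemma params_op_inst: "params {op_inst \<phi> t \<gamma>} \<subseteq> {\<gamma>}"
  by (auto simp: params_def op_inst_def fm.set_map)

lemma stages_le_Omega_op_inst: "\<gamma> \<le> \<Omega> \<Longrightarrow> stages_le_Omega (op_inst \<phi> t \<gamma>)"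
  using params_op_inst by (fastforce simp: stages_le_Omega_def)

lemma bound_neg: "bound \<beta> (neg \<psi>) = neg (bound \<beta> \<psi>)"
  by (simp add: bound_def map_fm_neg)

text \<open>Every predicate of \<open>op_inst \<phi> t \<gamma>\<close> carries the stage \<gamma>,
  so nothing is replaced. Hence a fixed-point literal and its bounded version share their auxiliary
  formulas.\<close>

lemma bound_op_inst: "\<gamma> \<noteq> \<Omega> \<Longrightarrow> bound \<beta> (op_inst \<phi> t \<gamma>) = op_inst \<phi> t \<gamma>"
  by (simp add: bound_def op_inst_def fm.map_comp comp_def)

lemma params_bound: "params {bound \<beta> \<psi>} \<subseteq> insert \<beta> (params {\<psi>})"
  by (force simp: params_def bound_def fm.set_map)

lemma params_Un: "params (\<Gamma> \<union> \<Delta>) = params \<Gamma> \<union> params \<Delta>"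
  by (simp add: params_def)

lemma params_bound_image: "params (bound \<beta> ` \<Psi>) \<subseteq> insert \<beta> (params \<Psi>)"
  using params_bound by (fastforce simp: params_def)

text \<open>The index set changes only for a fixed-point literal at stage \<Omega>, where it shrinks
  to \<beta>. The fourth conclusion supplies the premises of (Conj), the last one keeps the witness
  of (Disj). Equality with \<open>bound \<beta> (F \<gamma>)\<close> is claimed only below \<delta>:
  at \<gamma> = \<Omega>, \<open>bound\<close> would alter the instance.\<close>

lemma disj_of_bound:
  assumes "disj_of \<psi> \<delta> F" and "stages_le_Omega \<psi>" and "\<beta> < \<Omega>"
  obtains \<delta>' F' where "disj_of (bound \<beta> \<psi>) \<delta>' F'"
    and "\<And>\<gamma>. \<gamma> < \<delta> \<Longrightarrow> F' \<gamma> = bound \<beta> (F \<gamma>)"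
    and "\<And>\<gamma>. \<gamma> < \<delta> \<Longrightarrow> stages_le_Omega (F \<gamma>)"
    and "\<And>\<gamma>. \<gamma> < \<delta>' \<Longrightarrow> \<gamma> < \<delta>"
    and "\<And>\<gamma>. \<gamma> < \<delta> \<Longrightarrow> \<gamma> < \<beta> \<Longrightarrow> \<gamma> < \<delta>'"
  using assms(1)
proof cases
  case (1 s t)
  \<comment> \<open>The disjunction is empty, so the conditions on indices are vacuous and the
    arbitrary F can be kept.\<close>
  have "\<not> \<gamma> < onum 0" for \<gamma>
    by transfer (simp add: not_less_zero)
  with 1 show ?thesis
    by (intro that[of "onum 0" F]) (auto simp: bound_def intro: disj_of.intros)
next
  case (2 s t)
  have "\<not> \<gamma> < onum 0" for \<gamma>
    by transfer (simp add: not_less_zero)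
  with 2 show ?thesis
    by (intro that[of "onum 0" F]) (auto simp: bound_def intro: disj_of.intros)
next
  case (3 \<phi> t)
  have le: "\<delta> \<le> \<Omega>"
    using assms(2) 3 by (simp add: stages_le_Omega_def params_def)
  have below: "\<gamma> \<noteq> \<Omega>" "\<gamma> \<le> \<Omega>" if "\<gamma> < \<delta>" for \<gamma>
    using oterm_less_le_trans[OF that le] Omega_not_less_Omega by (auto intro: oterm_less_imp_le)
  let ?\<delta> = "if \<delta> = \<Omega> then \<beta> else \<delta>"
  have "disj_of (bound \<beta> \<psi>) ?\<delta> (\<lambda>\<gamma>. op_inst \<phi> t \<gamma>)"
    using 3 disj_of.intros(3)[of \<phi> ?\<delta> t] by (simp add: bound_def)
  moreover have "op_inst \<phi> t \<gamma> = bound \<beta> (F \<gamma>)" "stages_le_Omega (F \<gamma>)" if "\<gamma> < \<delta>" for \<gamma>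
    using below[OF that] 3 by (simp_all add: bound_op_inst stages_le_Omega_op_inst)
  moreover have "\<gamma> < \<delta>" if "\<gamma> < ?\<delta>" for \<gamma>
    using that oterm_less_trans[OF _ assms(3)] by (simp split: if_splits)
  moreover have "\<gamma> < ?\<delta>" if "\<gamma> < \<delta>" "\<gamma> < \<beta>" for \<gamma>
    using that by simp
  ultimately show ?thesis by (rule that)
next
  case (4 p q)
  have "disj_of (bound \<beta> \<psi>) (onum 2) (\<lambda>\<gamma>. if \<gamma> = onum 0 then bound \<beta> p else bound \<beta> q)"
    using 4 disj_of.intros(4)[of "bound \<beta> p" "bound \<beta> q"] by (simp add: bound_def)
  with 4 assms(2) show ?thesis
    by (intro that[of "onum 2" "\<lambda>\<gamma>. if \<gamma> = onum 0 then bound \<beta> p else bound \<beta> q"])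
      (auto simp: stages_le_Omega_def params_def)
next
  case (5 p)
  have "disj_of (bound \<beta> \<psi>) \<omega> (\<lambda>\<gamma>. subst 0 (numeral_trm (inv onum \<gamma>)) (bound \<beta> p))"
    using 5 disj_of.intros(5)[of "bound \<beta> p"] by (simp add: bound_def)
  with 5 assms(2) show ?thesis
    by (intro that[of \<omega> "\<lambda>\<gamma>. subst 0 (numeral_trm (inv onum \<gamma>)) (bound \<beta> p)"])
      (auto simp: stages_le_Omega_def params_def set_fm_subst bound_def map_fm_subst)
qed

text \<open>Dual to \<open>disj_of_bound\<close>, since \<open>bound\<close> commutes with
  \<open>neg\<close>. There is no witness to preserve here: a smaller index set only drops
  premises.\<close>

lemma conj_of_bound:
  assumes "conj_of \<psi> \<delta> F" and "stages_le_Omega \<psi>" and "\<beta> < \<Omega>"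
  obtains \<delta>' F' where "conj_of (bound \<beta> \<psi>) \<delta>' F'"
    and "\<And>\<gamma>. \<gamma> < \<delta> \<Longrightarrow> F' \<gamma> = bound \<beta> (F \<gamma>)"
    and "\<And>\<gamma>. \<gamma> < \<delta> \<Longrightarrow> stages_le_Omega (F \<gamma>)"
    and "\<And>\<gamma>. \<gamma> < \<delta>' \<Longrightarrow> \<gamma> < \<delta>"
  using assms(1)
proof cases
  case (1 \<chi> G)
  then have "stages_le_Omega \<chi>" using assms(2) by (simp add: stages_le_Omega_neg)
  from disj_of_bound[OF 1(3) this assms(3)] obtain \<delta>' G' where
    "disj_of (bound \<beta> \<chi>) \<delta>' G'" "\<And>\<gamma>. \<gamma> < \<delta> \<Longrightarrow> G' \<gamma> = bound \<beta> (G \<gamma>)"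
    "\<And>\<gamma>. \<gamma> < \<delta> \<Longrightarrow> stages_le_Omega (G \<gamma>)" "\<And>\<gamma>. \<gamma> < \<delta>' \<Longrightarrow> \<gamma> < \<delta>"
    by metis
  with 1 show ?thesis
    by (intro that[of \<delta>' "\<lambda>\<gamma>. neg (G' \<gamma>)"])
      (simp_all add: bound_neg stages_le_Omega_neg conj_of.intros)
qed

section \<open>Monotone operators and the induction on derivations\<close>

lemma mono_relativize: "mono H \<Longrightarrow> mono (relativize H Z)"
  unfolding mono_def relativize_def by (meson Un_mono order_refl)

text \<open>Monotonicity is what the induction carries along: it passes to the relativized operators
  of (Conj) and keeps \<beta> available there. It follows from the closure condition because X
  \<subseteq> Y \<subseteq> \<open>H Y\<close>.\<close>

lemma nice_imp_mono:
  assumes "nice H"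
  shows "mono H"
proof (rule monoI)
  fix X Y :: "oterm set"
  assume "X \<subseteq> Y"
  moreover have "Y \<subseteq> H Y" "X \<subseteq> H Y \<Longrightarrow> H X \<subseteq> H Y"
    using assms by (simp_all add: nice_def)
  ultimately show "H X \<subseteq> H Y" by (meson order_trans)
qed

text \<open>The split into \<Gamma> and \<Psi> may overlap and is chosen anew for each premise: an
  auxiliary formula joins the side on which its principal formula is treated.\<close>

lemma derives_bound_image:
  assumes "derives H \<alpha> \<rho> \<Delta>" and "\<Delta> = \<Gamma> \<union> \<Psi>" and "\<forall>\<psi> \<in> \<Psi>. stages_le_Omega \<psi>"
    and "mono H" and "\<beta> \<in> H {}" and "\<alpha> \<le> \<beta>" and "\<beta> < \<Omega>"
  shows "derives H \<alpha> \<rho> (\<Gamma> \<union> bound \<beta> ` \<Psi>)"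
  using assms(1-6)
proof (induction arbitrary: \<Gamma> \<Psi> rule: derives.induct)
  case (Conj \<alpha> \<Delta> H \<psi> \<delta> F \<rho>)
  \<comment> \<open>Bounding can add only the stage \<beta>, which lies in
    \<open>H {}\<close>.\<close>
  have side: "{\<alpha>} \<union> params (\<Gamma> \<union> bound \<beta> ` \<Psi>) \<subseteq> H {}"
    using Conj.hyps(1) Conj.prems params_bound_image[of \<beta> \<Psi>] by (auto simp: params_Un)
  have prem: "\<exists>\<alpha>'. \<alpha>' < \<alpha> \<and> derives (relativize H {\<gamma>}) \<alpha>' \<rho> (\<Gamma>' \<union> bound \<beta> ` \<Psi>')"
    if "\<gamma> < \<delta>" "\<Delta> \<union> {F \<gamma>} = \<Gamma>' \<union> \<Psi>'" "\<forall>\<psi> \<in> \<Psi>'. stages_le_Omega \<psi>" for \<gamma> \<Gamma>' \<Psi>'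
  proof -
    \<comment> \<open>By monotonicity, \<open>H {}\<close> is contained in
      \<open>H {\<gamma>}\<close>.\<close>
    have "\<beta> \<in> relativize H {\<gamma>} {}"
      using Conj.prems(4) monoD[OF Conj.prems(3), of "{}" "{\<gamma>}"] by (auto simp: relativize_def)
    with Conj.IH that Conj.prems mono_relativize show ?thesis
      by (meson oterm_less_le_trans oterm_less_imp_le)
  qed
  show ?case
  proof (cases "\<psi> \<in> \<Gamma>")
    case True
    have "\<exists>\<alpha>'. \<alpha>' < \<alpha> \<and> derives (relativize H {\<gamma>}) \<alpha>' \<rho> (\<Gamma> \<union> bound \<beta> ` \<Psi> \<union> {F \<gamma>})"
      if "\<gamma> < \<delta>" for \<gamma>
      using prem[OF that, of "\<Gamma> \<union> {F \<gamma>}" \<Psi>] Conj.prems by (simp add: Un_ac)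
    with True Conj.hyps(3) side show ?thesis by (blast intro: derives.Conj)
  next
    case False
    then have \<psi>: "\<psi> \<in> \<Psi>" using Conj.hyps Conj.prems by blast
    then have "stages_le_Omega \<psi>" using Conj.prems by blast
    from conj_of_bound[OF Conj.hyps(3) this assms(7)] obtain \<delta>' F' where
      F': "conj_of (bound \<beta> \<psi>) \<delta>' F'" "\<And>\<gamma>. \<gamma> < \<delta> \<Longrightarrow> F' \<gamma> = bound \<beta> (F \<gamma>)"
      "\<And>\<gamma>. \<gamma> < \<delta> \<Longrightarrow> stages_le_Omega (F \<gamma>)" "\<And>\<gamma>. \<gamma> < \<delta>' \<Longrightarrow> \<gamma> < \<delta>"
      by metis
    have "\<exists>\<alpha>'. \<alpha>' < \<alpha> \<and> derives (relativize H {\<gamma>}) \<alpha>' \<rho> (\<Gamma> \<union> bound \<beta> ` \<Psi> \<union> {F' \<gamma>})"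
      if "\<gamma> < \<delta>'" for \<gamma>
      using prem[OF F'(4)[OF that], of \<Gamma> "\<Psi> \<union> {F \<gamma>}"] Conj.prems F'(2-4) that by simp
    with \<psi> F'(1) side show ?thesis by (blast intro: derives.Conj)
  qed
next
  case (Disj \<alpha> \<Delta> H \<psi> \<delta> F \<gamma> \<alpha>' \<rho>)
  have side: "{\<alpha>} \<union> params (\<Gamma> \<union> bound \<beta> ` \<Psi>) \<subseteq> H {}"
    using Disj.hyps(1) Disj.prems params_bound_image[of \<beta> \<Psi>] by (auto simp: params_Un)
  have \<alpha>': "\<alpha>' \<le> \<beta>"
    using Disj.hyps Disj.prems by (blast intro: oterm_less_imp_le oterm_less_le_trans)
  show ?case
  proof (cases "\<psi> \<in> \<Gamma>")
    case True
    have "derives H \<alpha>' \<rho> (\<Gamma> \<union> bound \<beta> ` \<Psi> \<union> {F \<gamma>})"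
      using Disj.IH[of "\<Gamma> \<union> {F \<gamma>}" \<Psi>] Disj.prems \<alpha>' by (simp add: Un_ac)
    with True Disj.hyps side show ?thesis by (blast intro: derives.Disj)
  next
    case False
    then have \<psi>: "\<psi> \<in> \<Psi>" using Disj.hyps Disj.prems by blast
    then have "stages_le_Omega \<psi>" using Disj.prems by blast
    from disj_of_bound[OF Disj.hyps(3) this assms(7)] obtain \<delta>' F' where
      F': "disj_of (bound \<beta> \<psi>) \<delta>' F'" "\<And>\<gamma>. \<gamma> < \<delta> \<Longrightarrow> F' \<gamma> = bound \<beta> (F \<gamma>)"
      "\<And>\<gamma>. \<gamma> < \<delta> \<Longrightarrow> stages_le_Omega (F \<gamma>)" "\<And>\<gamma>. \<gamma> < \<delta> \<Longrightarrow> \<gamma> < \<beta> \<Longrightarrow> \<gamma> < \<delta>'"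
      by metis
    \<comment> \<open>The side condition \<gamma> < \<alpha> of (Disj) gives \<gamma> <
      \<beta>.\<close>
    have "\<gamma> < \<delta>'"
      using F'(4) Disj.hyps Disj.prems(5) by (blast intro: oterm_less_le_trans)
    moreover have "derives H \<alpha>' \<rho> (\<Gamma> \<union> bound \<beta> ` \<Psi> \<union> {F' \<gamma>})"
      using Disj.IH[of \<Gamma> "\<Psi> \<union> {F \<gamma>}"] Disj.prems Disj.hyps(4) F'(2,3) \<alpha>' by simp
    ultimately show ?thesis
      using \<psi> F'(1) side Disj.hyps by (blast intro: derives.Disj)
  qed
next
  case (Cut \<alpha> \<Delta> H \<psi> \<rho> \<alpha>')
  have side: "{\<alpha>} \<union> params (\<Gamma> \<union> bound \<beta> ` \<Psi>) \<subseteq> H {}"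
    using Cut.hyps(1) Cut.prems params_bound_image[of \<beta> \<Psi>] by (auto simp: params_Un)
  have \<alpha>': "\<alpha>' \<le> \<beta>"
    using Cut.hyps Cut.prems by (blast intro: oterm_less_imp_le oterm_less_le_trans)
  \<comment> \<open>Both cut formulas join \<Gamma>, so the rank condition of the cut carries over
    unchanged.\<close>
  have "derives H \<alpha>' \<rho> (\<Gamma> \<union> bound \<beta> ` \<Psi> \<union> {\<psi>})" "derives H \<alpha>' \<rho> (\<Gamma> \<union> bound \<beta> ` \<Psi> \<union> {neg \<psi>})"
    using Cut.IH(1)[of "\<Gamma> \<union> {\<psi>}" \<Psi>] Cut.IH(2)[of "\<Gamma> \<union> {neg \<psi>}" \<Psi>] Cut.prems \<alpha>'
    by (simp_all add: Un_ac)
  with Cut.hyps side show ?case by (blast intro: derives.Cut)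
next
  case (Fix \<alpha> \<Delta> H \<phi> t \<alpha>' \<rho>)
  then have "\<alpha> < \<Omega>" using assms(7) by (blast intro: oterm_le_less_trans)
  with Fix.hyps(2) show ?case
    using oterm_le_less_trans Omega_not_less_Omega by blast
qed

theorem theorem5p9:
  fixes H :: operator and \<alpha> \<beta> \<rho> :: oterm and \<Gamma> :: "form set" and \<psi> :: form
  assumes "nice H"
    and "sequent \<Gamma>" and "sentence \<psi>"
    and "derives H \<alpha> \<rho> (\<Gamma> \<union> {\<psi>})"
    and "\<beta> \<in> H {}" and "\<alpha> \<le> \<beta>" and "\<beta> < \<Omega>"
  shows "derives H \<alpha> \<rho> (\<Gamma> \<union> {bound \<beta> \<psi>})"
proof -
  have "stages_le_Omega \<psi>"
    using assms(3) by (auto simp: sentence_def stages_le_Omega_def params_def)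
  \<comment> \<open>Here \<Psi> is the singleton of \<psi>.\<close>
  with derives_bound_image[OF assms(4) refl _ nice_imp_mono[OF assms(1)] assms(5-7)]
  show ?thesis by simp
qed

end
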